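(* For every $k\in\mathbb{N}$ there exists a set $A_k\subset\mathbb{N}$ such that $\{1,\dots,k-1\}\subset A_k$, $k\notin A_k$, and both $\mathbb{N}\setminus A_k$ and $\Pr(A_k)$ are finite.
   Context: For $m\in\mathbb{N}$, $D(m)$ is the set of positive divisors of $m$. For $A\subset\mathbb{N}$, $S_A=\sum_{a\in A}a$ ($S_\emptyset=0$), and $A$ is a practical set if every non-negative integer $k\le S_A$ is a sum of distinct elements of $A$. A number $m\in\mathbb{N}$ is $A$-practical if $D(m)\cap A$ is a practical set, and $\Pr(A)$ is the set of all $A$-practical numbers. *)

theory Defs
  imports Main "HOL-Library.Extended_Nat"
begin

text \<open>
  The set of natural numbers of the mathematical text consists of the positive integers.
\<close>

definition pos_nats :: "nat set" where
  "pos_nats = {n. 0 < n}"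

definition divisor_set :: "nat \<Rightarrow> nat set" where
  "divisor_set m = {d \<in> pos_nats. d dvd m}"

text \<open>
  The sum over an infinite set of positive integers diverges.  Since \<^term>\<open>sum\<close> is zero
  on infinite sets, the value \<open>\<infinity>\<close> is given explicitly.
\<close>

definition elem_sum :: "nat set \<Rightarrow> enat" where
  "elem_sum A = (if finite A then enat (\<Sum>a\<in>A. a) else \<infinity>)"

definition practical_set :: "nat set \<Rightarrow> bool" where
  "practical_set A \<longleftrightarrow>
     (\<forall>k::nat. enat k \<le> elem_sum A \<longrightarrow> (\<exists>B. finite B \<and> B \<subseteq> A \<and> (\<Sum>b\<in>B. b) = k))"

definition rel_practical :: "nat set \<Rightarrow> nat \<Rightarrow> bool" where
  "rel_practical A m \<longleftrightarrow> practical_set (divisor_set m \<inter> A)"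

definition Pr :: "nat set \<Rightarrow> nat set" where
  "Pr A = {m \<in> pos_nats. rel_practical A m}"

end

theory Submission
  imports Defs
begin

text \<open>
  Take \<open>A = {1..<k} \<union> {k * k + 2..}\<close>. The integer \<open>k * k + 1\<close> is not a sum of distinct elements
  of \<open>A\<close>: the large elements exceed it and the small ones add up to less. If \<open>m \<ge> k * k + 2\<close>,
  then \<open>m\<close> itself lies in \<open>D(m) \<inter> A\<close>, so \<open>k * k + 1\<close> does not exceed the total sum,
  and \<open>m\<close> is not \<open>A\<close>-practical.
\<close>

lemma finite_divisor_set: "0 < m \<Longrightarrow> finite (divisor_set m)"
  by (simp add: divisor_set_def)

lemma sum_subset_with_gap_neq:
  fixes k :: nat
  assumes "finite B" and sub: "B \<subseteq> {1..<k} \<union> {k * k + 2..}"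
  shows "\<Sum>B \<noteq> k * k + 1"
proof
  assume eq: "\<Sum>B = k * k + 1"
  \<comment> \<open>No element of \<open>B\<close> exceeds the sum of \<open>B\<close>, which rules
    out those from \<open>k * k + 2\<close> on.\<close>
  have "b \<le> k * k + 1" if "b \<in> B" for b
    using member_le_sum[OF that, of "\<lambda>x. x"] \<open>finite B\<close> eq by simp
  with sub have small: "B \<subseteq> {1..<k}" by fastforce
  \<comment> \<open>Crude bounds suffice: at most \<open>k\<close> elements, each at most
    \<open>k\<close>. This is where the \<open>k * k\<close> in the choice of the gap comes
    from.\<close>
  then have "card B \<le> k"
    using card_mono[OF _ small] by simp
  moreover have "\<Sum>B \<le> card B * k"
    using sum_bounded_above[of B "\<lambda>x. x" k] small by force
  ultimately have "\<Sum>B \<le> k * k"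
    using mult_le_mono1 le_trans by blast
  with eq show False by simp
qed

lemma not_rel_practical_if_gap:
  assumes "k * k + 2 \<le> m"
  shows "\<not> rel_practical ({1..<k} \<union> {k * k + 2..}) m"
proof
  let ?S = "divisor_set m \<inter> ({1..<k} \<union> {k * k + 2..})"
  assume "rel_practical ({1..<k} \<union> {k * k + 2..}) m"
  then have pr: "practical_set ?S" by (simp add: rel_practical_def)
  have fin: "finite ?S" using assms by (simp add: finite_divisor_set)
  have "m \<in> ?S" using assms by (simp add: divisor_set_def pos_nats_def)
  then have "m \<le> \<Sum>?S" using member_le_sum[of m ?S "\<lambda>x. x"] fin by simp
  then have "enat (k * k + 1) \<le> elem_sum ?S"
    using fin assms by (simp add: elem_sum_def)
  with pr obtain B where "finite B" "B \<subseteq> ?S" "\<Sum>B = k * k + 1"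
    unfolding practical_set_def by blast
  then show False using sum_subset_with_gap_neq by blast
qed

theorem theorem4p4:
  "\<forall>k\<in>pos_nats. \<exists>A. A \<subseteq> pos_nats \<and> {1..k - 1} \<subseteq> A \<and> k \<notin> A \<and>
     finite (pos_nats - A) \<and> finite (Pr A)"
proof
  fix k :: nat
  assume "k \<in> pos_nats"
  then have "0 < k" by (simp add: pos_nats_def)
  let ?A = "{1..<k} \<union> {k * k + 2..}"
  have "?A \<subseteq> pos_nats" by (auto simp: pos_nats_def)
  moreover have "{1..k - 1} \<subseteq> ?A" using \<open>0 < k\<close> by auto
  moreover have "k \<notin> ?A"
    \<comment> \<open>Since \<open>k \<le> k * k\<close>, the number \<open>k\<close> itself falls
      into the gap.\<close>
    by (auto dest: le_trans[OF _ le_square])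
  moreover have "finite (pos_nats - ?A)"
    by (rule finite_subset[of _ "{..<k * k + 2}"]) auto
  moreover have "finite (Pr ?A)"
  proof (rule finite_subset)
    show "Pr ?A \<subseteq> {..<k * k + 2}"
      using not_rel_practical_if_gap by (force simp: Pr_def not_le[symmetric])
  qed simp
  ultimately show "\<exists>A. A \<subseteq> pos_nats \<and> {1..k - 1} \<subseteq> A \<and> k \<notin> A \<and>
     finite (pos_nats - A) \<and> finite (Pr A)"
    by blast
qed

end
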